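(* Let $T>0$. For any $\alpha\in(0,1)$ there exist $f\in C^\infty(\mathbb R^3\times[0,T))\cap C^{0,\alpha}(\mathbb R^3\times[0,T])$ and $V_0\in\mathcal G_\sigma\subset C^\infty(\mathbb R^3)$ such that the Euler problem $$V_t+(V\cdot\nabla)V+\nabla P=f,\quad\nabla\cdot V=0,\qquad V(\xi,0)=V_0(\xi)\ \text{ in }\mathbb R^3,$$ admits a solution $(V,P)$ satisfying $$V\in C^\infty(\mathbb R^3\times[0,T))\cap C^{0,\alpha}(\mathbb R^3\times[0,T]),\qquad\lim_{t\to T}\int_0^t\|\nabla\wedge V(s)\|_{L^\infty(\mathbb R^3)}\,ds=\infty,\qquad P\in C^{1,\alpha}(\mathbb R^3\times[0,T]).$$
   Context: $\nabla\wedge V$ denotes the curl (vorticity) of $V$. All fields $V,f$ are $\mathbb R^3$-valued, $P$ is scalar; the equations are considered for $(\xi,t)\in\mathbb R^3\times[0,T)$. The space of initial data is $$\mathcal G=\bigcap_{k\in\mathbb N}\bigcap_{q\in[2,\infty]}W^{k,q}(\mathbb R^3)\subset C^\infty(\mathbb R^3),\qquad \mathcal G_\sigma=\{V\in\mathcal G:\ \nabla\cdot V=0\text{ in }\mathbb R^3\}.$$ *)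

theory Defs
  imports "HOL-Analysis.Analysis" "HOL-Probability.Essential_Supremum"
begin

text \<open>
  The set \<open>S\<close> need not be open: derivatives are taken within \<open>S\<close>, so they are
  one-sided at boundary points. This is meant for convex \<open>S\<close> with nonempty interior (such as
  \<open>UNIV\<close>, \<open>UNIV \<times> {0..<T}\<close> and \<open>UNIV \<times> {0..T}\<close>), where the derivative
  within \<open>S\<close> is unique and \<open>Ck_on\<close> says that all derivatives of order up to \<open>k\<close>
  exist and are continuous up to the part of the boundary that belongs to \<open>S\<close>.
\<close>

primrec Ck_on ::
  "nat \<Rightarrow> 'a::euclidean_space set \<Rightarrow> ('a \<Rightarrow> 'b::euclidean_space) \<Rightarrow> bool"
where
  "Ck_on 0 S u \<longleftrightarrow> continuous_on S u"
| "Ck_on (Suc k) S u \<longleftrightarrow>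
     (\<exists>u'. (\<forall>p\<in>S. (u has_derivative u' p) (at p within S)) \<and>
           (\<forall>v. Ck_on k S (\<lambda>p. u' p v)))"

definition smooth_on :: "'a::euclidean_space set \<Rightarrow> ('a \<Rightarrow> 'b::euclidean_space) \<Rightarrow> bool"
  where "smooth_on S u \<longleftrightarrow> (\<forall>k. Ck_on k S u)"

text \<open>
  The Hoelder space \<open>C\<^sup>k\<^sup>,\<^sup>\<alpha>(S)\<close> of functions with finite Hoelder norm: all derivatives of order
  up to \<open>k\<close> are bounded on \<open>S\<close> and those of order \<open>k\<close> are uniformly Hoelder
  continuous with exponent \<open>\<alpha>\<close>. If \<open>S\<close> is a set of space-time points, this means
  derivatives and Hoelder continuity in space and time jointly.
\<close>

primrec holder_on ::
  "nat \<Rightarrow> real \<Rightarrow> 'a::euclidean_space set \<Rightarrow> ('a \<Rightarrow> 'b::euclidean_space) \<Rightarrow> bool"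
where
  "holder_on 0 \<alpha> S u \<longleftrightarrow>
     bounded (u ` S) \<and>
     (\<exists>C. \<forall>p\<in>S. \<forall>q\<in>S. norm (u p - u q) \<le> C * dist p q powr \<alpha>)"
| "holder_on (Suc k) \<alpha> S u \<longleftrightarrow>
     bounded (u ` S) \<and>
     (\<exists>u'. (\<forall>p\<in>S. (u has_derivative u' p) (at p within S)) \<and>
           (\<forall>v. holder_on k \<alpha> S (\<lambda>p. u' p v)))"

definition partial_deriv ::
  "3 \<Rightarrow> (real^3 \<Rightarrow> 'b::euclidean_space) \<Rightarrow> real^3 \<Rightarrow> 'b"
  where "partial_deriv i u x = frechet_derivative u (at x) (axis i 1)"

definition multi_deriv ::
  "nat^3 \<Rightarrow> (real^3 \<Rightarrow> 'b::euclidean_space) \<Rightarrow> real^3 \<Rightarrow> 'b"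
  where "multi_deriv \<beta> u =
    ((partial_deriv 1 ^^ (\<beta> $ 1)) ((partial_deriv 2 ^^ (\<beta> $ 2)) ((partial_deriv 3 ^^ (\<beta> $ 3)) u)))"

definition multi_order :: "nat^3 \<Rightarrow> nat"
  where "multi_order \<beta> = (\<Sum>i\<in>UNIV. \<beta> $ i)"

definition grad :: "(real^3 \<Rightarrow> real) \<Rightarrow> real^3 \<Rightarrow> real^3"
  where "grad p x = (\<chi> i. partial_deriv i p x)"

definition divergence :: "(real^3 \<Rightarrow> real^3) \<Rightarrow> real^3 \<Rightarrow> real"
  where "divergence v x = (\<Sum>i\<in>UNIV. partial_deriv i (\<lambda>y. v y $ i) x)"

definition curl :: "(real^3 \<Rightarrow> real^3) \<Rightarrow> real^3 \<Rightarrow> real^3"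
  where "curl v x = vector
    [partial_deriv 2 (\<lambda>y. v y $ 3) x - partial_deriv 3 (\<lambda>y. v y $ 2) x,
     partial_deriv 3 (\<lambda>y. v y $ 1) x - partial_deriv 1 (\<lambda>y. v y $ 3) x,
     partial_deriv 1 (\<lambda>y. v y $ 2) x - partial_deriv 2 (\<lambda>y. v y $ 1) x]"

definition convection :: "(real^3 \<Rightarrow> real^3) \<Rightarrow> real^3 \<Rightarrow> real^3"
  where "convection v x = (\<Sum>i\<in>UNIV. v x $ i *\<^sub>R partial_deriv i v x)"

definition Linf_norm :: "(real^3 \<Rightarrow> 'b::euclidean_space) \<Rightarrow> ennreal"
  where "Linf_norm u = esssup lebesgue (\<lambda>x. ennreal (norm (u x)))"

text \<open>
  Elements of \<open>L\<^sup>q\<close> and of \<open>W\<^sup>k\<^sup>,\<^sup>q\<close> are represented by functions, not by classes modulo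
  almost everywhere equality. The exponent ranges over \<open>[1, \<infinity>]\<close>.
\<close>

definition Lq_space :: "ennreal \<Rightarrow> (real^3 \<Rightarrow> 'b::euclidean_space) set"
  where "Lq_space q = {u \<in> borel_measurable lebesgue.
    if q = \<infinity> then Linf_norm u < \<infinity>
    else (\<integral>\<^sup>+ x. ennreal (norm (u x) powr enn2real q) \<partial>lebesgue) < \<infinity>}"

definition test_function :: "(real^3 \<Rightarrow> real) \<Rightarrow> bool"
  where "test_function \<phi> \<longleftrightarrow> smooth_on UNIV \<phi> \<and> compact (closure {x. \<phi> x \<noteq> 0})"

definition weak_deriv ::
  "nat^3 \<Rightarrow> (real^3 \<Rightarrow> 'b::euclidean_space) \<Rightarrow> (real^3 \<Rightarrow> 'b) \<Rightarrow> bool"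
  where "weak_deriv \<beta> u w \<longleftrightarrow> (\<forall>\<phi>. test_function \<phi> \<longrightarrow>
    (\<integral>x. multi_deriv \<beta> \<phi> x *\<^sub>R u x \<partial>lebesgue) =
    (-1) ^ multi_order \<beta> *\<^sub>R (\<integral>x. \<phi> x *\<^sub>R w x \<partial>lebesgue))"

definition sobolev_space :: "nat \<Rightarrow> ennreal \<Rightarrow> (real^3 \<Rightarrow> 'b::euclidean_space) set"
  where "sobolev_space k q = {u \<in> Lq_space q.
    \<forall>\<beta>. multi_order \<beta> \<le> k \<longrightarrow> (\<exists>w\<in>Lq_space q. weak_deriv \<beta> u w)}"

text \<open>
  By Sobolev embedding every class in the intersection of the spaces \<open>W\<^sup>k\<^sup>,\<^sup>q\<close> has exactly one
  smooth representative; the condition \<open>smooth_on UNIV V\<close> selects it.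
\<close>

definition data_space :: "(real^3 \<Rightarrow> real^3) set"
  where "data_space =
    {V. smooth_on UNIV V} \<inter> (\<Inter>k. \<Inter>q\<in>{2..\<infinity>}. sobolev_space k q)"

definition solenoidal_data_space :: "(real^3 \<Rightarrow> real^3) set"
  where "solenoidal_data_space = {V \<in> data_space. \<forall>x. divergence V x = 0}"

text \<open>
  Fields on space-time are functions on \<open>(real^3) \<times> real\<close>, whose values at times outside
  \<open>[0, T]\<close> are irrelevant; accordingly the time derivative at \<open>t = 0\<close> is one-sided.
  Differentiability is not part of this predicate and is to be required separately.
\<close>

definition euler_solution ::
  "real \<Rightarrow> ((real^3) \<times> real \<Rightarrow> real^3) \<Rightarrow> (real^3 \<Rightarrow> real^3)
    \<Rightarrow> ((real^3) \<times> real \<Rightarrow> real^3) \<Rightarrow> ((real^3) \<times> real \<Rightarrow> real) \<Rightarrow> bool"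
  where "euler_solution T f V0 V P \<longleftrightarrow>
    (\<forall>x. \<forall>t\<in>{0..<T}.
       vector_derivative (\<lambda>s. V (x, s)) (at t within {0..<T})
         + convection (\<lambda>y. V (y, t)) x + grad (\<lambda>y. P (y, t)) x = f (x, t)
       \<and> divergence (\<lambda>y. V (y, t)) x = 0) \<and>
    (\<forall>x. V (x, 0) = V0 x)"

definition vorticity_integral :: "((real^3) \<times> real \<Rightarrow> real^3) \<Rightarrow> real \<Rightarrow> ennreal"
  where "vorticity_integral V t =
    (\<integral>\<^sup>+ s \<in> {0..t}. Linf_norm (curl (\<lambda>x. V (x, s))) \<partial>lborel)"

end

theory Submission
  imports Defs
begin

text \<open>
  A parallel shear flow \<open>V = U(y, t) e\<^sub>1\<close> with \<open>P = 0\<close> has no convection term, so that the Euler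
  equation reduces to \<open>f = U\<^sub>t e\<^sub>1\<close>, and the vorticity is \<open>- U\<^sub>y e\<^sub>3\<close>. Let \<open>s = T - t\<close> be the time to go
  and \<open>G(y, s) = s ^ (n - 1) w(y / s ^ n)\<close> with \<open>w(z) = 1 / (1 + z\<^sup>2)\<close>. Then \<open>sup \<bar>G\<^sub>y\<bar>\<close> is of size
  \<open>1 / s\<close>, which is not integrable up to \<open>s = 0\<close>, whereas \<open>G\<^sub>s\<close> is of the form
  \<open>s ^ (n - 2) k(y / s ^ n)\<close> and hence uniformly Hoelder continuous with exponent \<open>\<alpha>\<close> as soon as
  \<open>n - 2 \<ge> \<alpha> n\<close>. Taking \<open>U(y, t) = G(y, T - t) - G(y, T)\<close> makes the initial velocity vanish, so
  that it lies in the data space although \<open>V\<close> does not decay.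
\<close>

section \<open>Functions of class \<open>Ck_on\<close>\<close>

lemma Ck_on_SucI:
  assumes "\<And>p. p \<in> S \<Longrightarrow> (u has_derivative u' p) (at p within S)"
    and "\<And>v. Ck_on k S (\<lambda>p. u' p v)"
  shows "Ck_on (Suc k) S u"
  using assms by auto

lemma Ck_on_SucE:
  assumes "Ck_on (Suc k) S u"
  obtains u' where "\<And>p. p \<in> S \<Longrightarrow> (u has_derivative u' p) (at p within S)"
    and "\<And>v. Ck_on k S (\<lambda>p. u' p v)"
  using assms by auto

text \<open>The recursive clause speaks of the derivative alone, so monotonicity in the order is an
  induction whose base case is that differentiability implies continuity.\<close>

lemma Ck_on_Suc_imp_Ck_on: "Ck_on (Suc k) S u \<Longrightarrow> Ck_on k S u"
proof (induction k arbitrary: u)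
  case 0
  then show ?case
    by (auto intro: has_derivative_continuous_on)
next
  case (Suc k)
  from Suc.prems obtain u' where
    "\<forall>p\<in>S. (u has_derivative u' p) (at p within S)" "\<forall>v. Ck_on (Suc k) S (\<lambda>p. u' p v)"
    unfolding Ck_on.simps(2)[of "Suc k"] by blast
  with Suc.IH show ?case by (intro Ck_on_SucI[where u' = u']) blast+
qed

lemma Ck_on_const: "Ck_on k S (\<lambda>p. c)"
proof (induction k arbitrary: c)
  case (Suc k)
  show ?case by (rule Ck_on_SucI[where u' = "\<lambda>_ _. 0"]) (auto simp: Suc.IH)
qed simp

lemma Ck_on_bounded_linear:
  assumes "bounded_linear L"
  shows "Ck_on k S L"
proof (cases k)
  case 0
  then show ?thesis using assms by (simp add: linear_continuous_on)
next
  case (Suc j)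
  show ?thesis unfolding Suc
    by (rule Ck_on_SucI[where u' = "\<lambda>_. L"])
       (auto simp: Ck_on_const bounded_linear.has_derivative[OF assms has_derivative_ident]
          intro: bounded_linear_imp_has_derivative[OF assms])
qed

lemma Ck_on_compose_bounded_linear:
  assumes "bounded_linear L" and "Ck_on k S u"
  shows "Ck_on k S (\<lambda>p. L (u p))"
  using assms(2)
proof (induction k arbitrary: u)
  case 0
  then show ?case
    using assms(1) by (auto intro: bounded_linear.continuous_on)
next
  case (Suc k)
  obtain u' where
    u: "\<And>p. p \<in> S \<Longrightarrow> (u has_derivative u' p) (at p within S)" "\<And>v. Ck_on k S (\<lambda>p. u' p v)"
    using Ck_on_SucE[OF Suc.prems] by blast
  show ?case
    using bounded_linear.has_derivative[OF assms(1) u(1)] Suc.IH[OF u(2)] by (rule Ck_on_SucI)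
qed

lemma Ck_on_add:
  assumes "Ck_on k S u" and "Ck_on k S w"
  shows "Ck_on k S (\<lambda>p. u p + w p)"
  using assms
proof (induction k arbitrary: u w)
  case 0
  then show ?case by (auto intro: continuous_intros)
next
  case (Suc k)
  obtain u' where
    u: "\<And>p. p \<in> S \<Longrightarrow> (u has_derivative u' p) (at p within S)" "\<And>v. Ck_on k S (\<lambda>p. u' p v)"
    using Ck_on_SucE[OF Suc.prems(1)] by blast
  obtain w' where
    w: "\<And>p. p \<in> S \<Longrightarrow> (w has_derivative w' p) (at p within S)" "\<And>v. Ck_on k S (\<lambda>p. w' p v)"
    using Ck_on_SucE[OF Suc.prems(2)] by blast
  show ?case
    using has_derivative_add[OF u(1) w(1)] Suc.IH[OF u(2) w(2)] by (rule Ck_on_SucI)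
qed

text \<open>The product rule yields products of one factor with the derivative of the other; the
  induction hypothesis applies to them once \<open>u\<close> and \<open>w\<close> themselves are
  lowered to order \<open>k\<close>.\<close>

lemma Ck_on_mult:
  fixes u w :: "'a::euclidean_space \<Rightarrow> real"
  assumes "Ck_on k S u" and "Ck_on k S w"
  shows "Ck_on k S (\<lambda>p. u p * w p)"
  using assms
proof (induction k arbitrary: u w)
  case 0
  then show ?case by (auto intro: continuous_intros)
next
  case (Suc k)
  obtain u' where
    u: "\<And>p. p \<in> S \<Longrightarrow> (u has_derivative u' p) (at p within S)" "\<And>v. Ck_on k S (\<lambda>p. u' p v)"
    using Ck_on_SucE[OF Suc.prems(1)] by blast
  obtain w' where
    w: "\<And>p. p \<in> S \<Longrightarrow> (w has_derivative w' p) (at p within S)" "\<And>v. Ck_on k S (\<lambda>p. w' p v)"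
    using Ck_on_SucE[OF Suc.prems(2)] by blast
  have "Ck_on k S u" "Ck_on k S w"
    using Suc.prems Ck_on_Suc_imp_Ck_on by blast+
  then have "Ck_on k S (\<lambda>p. u p * w' p v + u' p v * w p)" for v
    using u(2) w(2) by (intro Ck_on_add Suc.IH)
  with has_derivative_mult[OF u(1) w(1)] show ?case by (rule Ck_on_SucI)
qed

text \<open>The derivative \<open>- (inverse u * u' v * inverse u)\<close> contains the inverse
  again, but only at order \<open>k\<close>, where the induction hypothesis covers it.\<close>

lemma Ck_on_inverse:
  fixes u :: "'a::euclidean_space \<Rightarrow> real"
  assumes "Ck_on k S u" and nz: "\<And>p. p \<in> S \<Longrightarrow> u p \<noteq> 0"
  shows "Ck_on k S (\<lambda>p. inverse (u p))"
  using assms(1)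
proof (induction k)
  case 0
  then show ?case using nz by (auto intro: continuous_intros)
next
  case (Suc k)
  obtain u' where
    u: "\<And>p. p \<in> S \<Longrightarrow> (u has_derivative u' p) (at p within S)" "\<And>v. Ck_on k S (\<lambda>p. u' p v)"
    using Ck_on_SucE[OF Suc.prems] by blast
  have "Ck_on k S (\<lambda>p. inverse (u p))"
    using Suc Ck_on_Suc_imp_Ck_on by blast
  then have "Ck_on k S (\<lambda>p. (-1) * (inverse (u p) * u' p v * inverse (u p)))" for v
    using u(2) by (intro Ck_on_mult Ck_on_const)
  then have "Ck_on k S (\<lambda>p. - (inverse (u p) * u' p v * inverse (u p)))" for v
    by simp
  with Deriv.has_derivative_inverse[OF nz u(1)] show ?case by (rule Ck_on_SucI)
qed

lemma smooth_on_const: "smooth_on S (\<lambda>p. c)"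
  by (simp add: smooth_on_def Ck_on_const)

lemma smooth_on_bounded_linear: "bounded_linear L \<Longrightarrow> smooth_on S L"
  by (simp add: smooth_on_def Ck_on_bounded_linear)

lemma smooth_on_compose_bounded_linear:
  "bounded_linear L \<Longrightarrow> smooth_on S u \<Longrightarrow> smooth_on S (\<lambda>p. L (u p))"
  by (simp add: smooth_on_def Ck_on_compose_bounded_linear)

lemma smooth_on_add: "smooth_on S u \<Longrightarrow> smooth_on S w \<Longrightarrow> smooth_on S (\<lambda>p. u p + w p)"
  by (simp add: smooth_on_def Ck_on_add)

lemma smooth_on_minus: "smooth_on S u \<Longrightarrow> smooth_on S (\<lambda>p. - u p)"
  by (rule smooth_on_compose_bounded_linear[OF bounded_linear_minus[OF bounded_linear_ident]])

lemma smooth_on_diff: "smooth_on S u \<Longrightarrow> smooth_on S w \<Longrightarrow> smooth_on S (\<lambda>p. u p - w p)"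
  using smooth_on_add[OF _ smooth_on_minus, of S u w] by simp

lemma smooth_on_mult:
  fixes u w :: "'a::euclidean_space \<Rightarrow> real"
  shows "smooth_on S u \<Longrightarrow> smooth_on S w \<Longrightarrow> smooth_on S (\<lambda>p. u p * w p)"
  by (simp add: smooth_on_def Ck_on_mult)

lemma smooth_on_power:
  fixes u :: "'a::euclidean_space \<Rightarrow> real"
  assumes "smooth_on S u"
  shows "smooth_on S (\<lambda>p. u p ^ n)"
  by (induction n) (auto intro: smooth_on_const smooth_on_mult assms)

lemma smooth_on_divide:
  fixes u w :: "'a::euclidean_space \<Rightarrow> real"
  assumes "smooth_on S u" and "smooth_on S w" and "\<And>p. p \<in> S \<Longrightarrow> w p \<noteq> 0"
  shows "smooth_on S (\<lambda>p. u p / w p)"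
  using assms by (simp add: divide_inverse smooth_on_def Ck_on_mult Ck_on_inverse)

section \<open>Hoelder continuous functions\<close>

lemma holder_on_const: "holder_on k \<alpha> S (\<lambda>p. c)"
proof (induction k arbitrary: c)
  case 0
  have "\<forall>p\<in>S. \<forall>q\<in>S. norm (c - c) \<le> 0 * dist p q powr \<alpha>" by simp
  moreover have "bounded ((\<lambda>p. c) ` S)" by (auto simp: bounded_iff)
  ultimately show ?case unfolding holder_on.simps by blast
next
  case (Suc k)
  have "bounded ((\<lambda>p. c) ` S)" by (auto simp: bounded_iff)
  moreover have "\<forall>p\<in>S. ((\<lambda>p. c) has_derivative (\<lambda>v. 0)) (at p within S)" by simp
  ultimately show ?case
    using Suc.IH[of 0] unfolding holder_on.simps by (intro conjI exI[of _ "\<lambda>_ _. 0"]) auto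
qed

lemma holder_on_0_compose_bounded_linear:
  assumes "bounded_linear L" and "holder_on 0 \<alpha> S u"
  shows "holder_on 0 \<alpha> S (\<lambda>p. L (u p))"
proof -
  interpret bounded_linear L by fact
  obtain K where K: "\<And>x. norm (L x) \<le> norm x * K" "0 \<le> K"
    using nonneg_bounded by blast
  obtain C where C: "\<And>p q. p \<in> S \<Longrightarrow> q \<in> S \<Longrightarrow> norm (u p - u q) \<le> C * dist p q powr \<alpha>"
    using assms(2) by auto
  have "norm (L (u p) - L (u q)) \<le> (C * K) * dist p q powr \<alpha>" if "p \<in> S" "q \<in> S" for p q
  proof -
    have "norm (L (u p) - L (u q)) \<le> norm (u p - u q) * K"
      using K(1)[of "u p - u q"] by (simp add: diff)
    also have "\<dots> \<le> C * dist p q powr \<alpha> * K"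
      using C[OF that] K(2) by (rule mult_right_mono)
    finally show ?thesis by (simp add: mult_ac)
  qed
  moreover have "bounded ((\<lambda>p. L (u p)) ` S)"
    using bounded_linear_image[OF _ assms(1), of "u ` S"] assms(2) by (simp add: image_image)
  ultimately show ?thesis unfolding holder_on.simps by blast
qed

lemma holder_on_0_add:
  assumes "holder_on 0 \<alpha> S u" and "holder_on 0 \<alpha> S w"
  shows "holder_on 0 \<alpha> S (\<lambda>p. u p + w p)"
proof -
  obtain C where
    C: "\<And>p q. p \<in> S \<Longrightarrow> q \<in> S \<Longrightarrow> norm (u p - u q) \<le> C * dist p q powr \<alpha>"
    using assms(1) by auto
  obtain D where
    D: "\<And>p q. p \<in> S \<Longrightarrow> q \<in> S \<Longrightarrow> norm (w p - w q) \<le> D * dist p q powr \<alpha>"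
    using assms(2) by auto
  have "norm (u p + w p - (u q + w q)) \<le> (C + D) * dist p q powr \<alpha>" if "p \<in> S" "q \<in> S" for p q
    using norm_diff_triangle_ineq[of "u p" "w p" "u q" "w q"] C[OF that] D[OF that]
    by (simp add: algebra_simps)
  moreover have "bounded ((\<lambda>p. u p + w p) ` S)"
    using assms by (auto intro: bounded_plus_comp)
  ultimately show ?thesis unfolding holder_on.simps by blast
qed

lemma holder_on_0_diff:
  assumes "holder_on 0 \<alpha> S u" and "holder_on 0 \<alpha> S w"
  shows "holder_on 0 \<alpha> S (\<lambda>p. u p - w p)"
  using holder_on_0_add[OF assms(1) holder_on_0_compose_bounded_linear[OF _ assms(2), of uminus]]
  by (simp add: bounded_linear_minus[OF bounded_linear_ident])

text \<open>Meant for freezing the time variable, which does not increase distances in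
  space-time.\<close>

lemma holder_on_0_compose_nonexpansive:
  assumes "0 \<le> \<alpha>" "holder_on 0 \<alpha> S u" "\<And>p. p \<in> R \<Longrightarrow> \<phi> p \<in> S"
    and "\<And>p q. p \<in> R \<Longrightarrow> q \<in> R \<Longrightarrow> dist (\<phi> p) (\<phi> q) \<le> dist p q"
  shows "holder_on 0 \<alpha> R (\<lambda>p. u (\<phi> p))"
proof -
  obtain C where C: "\<And>p q. p \<in> S \<Longrightarrow> q \<in> S \<Longrightarrow> norm (u p - u q) \<le> C * dist p q powr \<alpha>"
    using assms(2) by auto
  have "norm (u (\<phi> p) - u (\<phi> q)) \<le> \<bar>C\<bar> * dist p q powr \<alpha>" if "p \<in> R" "q \<in> R" for p q
  proof -
    have "norm (u (\<phi> p) - u (\<phi> q)) \<le> C * dist (\<phi> p) (\<phi> q) powr \<alpha>"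
      using that by (intro C assms(3))
    \<comment> \<open>The constant comes without a sign, so its absolute value is taken before the
      distance is enlarged.\<close>
    also have "\<dots> \<le> \<bar>C\<bar> * dist p q powr \<alpha>"
      using assms(1,4) that by (intro mult_mono powr_mono2) auto
    finally show ?thesis .
  qed
  moreover have "bounded ((\<lambda>p. u (\<phi> p)) ` R)"
    by (rule bounded_subset[of "u ` S"]) (use assms(2,3) in auto)
  ultimately show ?thesis unfolding holder_on.simps by blast
qed

text \<open>Interpolation between a Lipschitz bound and the bound 1: for \<open>d \<le> 1\<close>
  one has \<open>d \<le> d powr \<alpha>\<close>, and for \<open>d > 1\<close> the right-hand side
  already exceeds 1.\<close>

lemma le_powr_interpolate:
  fixes d L \<alpha> :: real
  assumes "0 < \<alpha>" "\<alpha> < 1" "0 \<le> d" "1 \<le> L" "e \<le> L * d" "e \<le> 1"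
  shows "e \<le> L * d powr \<alpha>"
proof (cases "d \<le> 1")
  case True
  have "d powr 1 \<le> d powr \<alpha>"
    using assms True by (intro powr_mono') auto
  then have "L * d \<le> L * d powr \<alpha>" using assms by simp
  with assms show ?thesis by linarith
next
  case False
  then have "1 \<le> d powr \<alpha>" using assms by (intro ge_one_powr_ge_zero) auto
  then have "1 * 1 \<le> L * d powr \<alpha>" using assms by (intro mult_mono) auto
  with assms show ?thesis by linarith
qed

section \<open>The concentrating profile\<close>

text \<open>
  For \<open>s > 0\<close> this is \<open>w(y / s ^ n)\<close> with \<open>w(z) = 1 / (1 + z\<^sup>2)\<close>. All derivatives along scalings are
  polynomials in \<open>w\<close>, because \<open>z w'(z) = - 2 w (1 - w)\<close>.
\<close>

definition profile :: "nat \<Rightarrow> real \<Rightarrow> real \<Rightarrow> real"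
  where "profile n y s = s ^ (2 * n) / (s ^ (2 * n) + y\<^sup>2)"

lemma profile_nonneg: "0 \<le> profile n y s"
  by (simp add: profile_def)

lemma profile_le_1: "profile n y s \<le> 1"
  using divide_right_mono[of "s ^ (2 * n)" "s ^ (2 * n) + y\<^sup>2" "s ^ (2 * n) + y\<^sup>2"]
  by (simp add: profile_def divide_self_if split: if_splits)

lemma profile_denom_pos: "0 < s \<Longrightarrow> 0 < s ^ (2 * n) + (y::real)\<^sup>2"
  by (simp add: add_pos_nonneg)

section \<open>Derivatives of the profile and their size\<close>

definition profile_dy :: "nat \<Rightarrow> real \<Rightarrow> real \<Rightarrow> real"
  where "profile_dy n y s = - 2 * y * s ^ (2 * n) / (s ^ (2 * n) + y\<^sup>2)\<^sup>2"

lemma profile_has_dy: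
  assumes "0 < s"
  shows "((\<lambda>y. profile n y s) has_real_derivative profile_dy n y s) (at y within A)"
  unfolding profile_def profile_dy_def
  using profile_denom_pos[OF assms, of n y]
  by (auto intro!: derivative_eq_intros simp: power2_eq_square)

text \<open>For \<open>z = y / s ^ n\<close> the chain rule gives \<open>dz/ds = - n z / s\<close>,
  and \<open>z w'(z) = - 2 w (1 - w)\<close> turns the result into a polynomial in \<open>w\<close>
  divided by \<open>s\<close>.\<close>

lemma profile_has_ds:
  assumes "0 < s" "0 < n"
  shows "(profile n y has_real_derivative 2 * n / s * (profile n y s * (1 - profile n y s)))
    (at s within A)"
proof -
  let ?D = "s ^ (2 * n) + y\<^sup>2"
  have D: "?D \<noteq> 0" using profile_denom_pos[OF assms(1), of n y] by simp
  have s: "s ^ (2 * n - Suc 0) = s ^ (2 * n) / s"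
    using assms by (simp add: power_diff)
  have "(profile n y has_real_derivative
      (2 * n * s ^ (2 * n - Suc 0) * ?D - s ^ (2 * n) * (2 * n * s ^ (2 * n - Suc 0))) / (?D * ?D))
    (at s within A)"
    unfolding profile_def[abs_def]
    using D by (auto intro!: derivative_eq_intros)
  moreover have "(2 * n * s ^ (2 * n - Suc 0) * ?D - s ^ (2 * n) * (2 * n * s ^ (2 * n - Suc 0))) / (?D * ?D)
     = 2 * n / s * (profile n y s * (1 - profile n y s))"
    unfolding s profile_def using D assms by (simp add: field_simps)
  ultimately show ?thesis by simp
qed

text \<open>With \<open>a = s ^ n\<close> and \<open>D = a\<^sup>2 + y\<^sup>2\<close>, multiply
  \<open>2 \<bar>y\<bar> a \<le> D\<close>, which is
  \<open>0 \<le> (\<bar>y\<bar> - a)\<^sup>2\<close>, by \<open>a\<^sup>2 \<le> D\<close>.\<close>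

lemma abs_profile_dy_le:
  assumes "0 < s"
  shows "\<bar>profile_dy n y s\<bar> \<le> 1 / s ^ n"
proof -
  let ?D = "s ^ (2 * n) + y\<^sup>2" and ?a = "s ^ n"
  have a: "0 < ?a" using assms by simp
  have D: "0 < ?D" using profile_denom_pos[OF assms] .
  have sq: "s ^ (2 * n) = ?a * ?a" by (simp add: mult_2 power_add)
  have 1: "2 * \<bar>y\<bar> * ?a \<le> ?D"
    using zero_le_power2[of "\<bar>y\<bar> - ?a"] unfolding sq by (simp add: power2_eq_square algebra_simps)
  have 2: "?a * ?a \<le> ?D" by (simp add: sq)
  have "2 * \<bar>y\<bar> * ?a * (?a * ?a) \<le> ?D * ?D"
    using 1 2 a by (intro mult_mono) auto
  moreover have "\<bar>profile_dy n y s\<bar> = 2 * \<bar>y\<bar> * (?a * ?a) / (?D * ?D)"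
    unfolding profile_dy_def using D a
    by (simp add: abs_mult power2_eq_square sq)
  moreover have "N / E \<le> 1 / c" if "N * c \<le> E" "0 < c" "0 < E" for N E c :: real
    using that by (simp add: field_simps)
  ultimately show ?thesis
    using a D by (simp add: mult_ac)
qed

text \<open>The value \<open>w'(1) = - 1/2\<close>: the preceding bound is sharp up to a factor 2,
  which later bounds the vorticity from below.\<close>

lemma profile_dy_at_scale:
  assumes "0 < s"
  shows "profile_dy n (s ^ n) s = - 1 / (2 * s ^ n)"
proof -
  have "- 2 * a * a\<^sup>2 / (a\<^sup>2 + a\<^sup>2)\<^sup>2 = - 1 / (2 * a)" if "0 < a" for a :: real
    using that by (simp add: power2_eq_square field_simps)
  then show ?thesis
    unfolding profile_dy_def power_even_eq using assms by simp
qed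

section \<open>Hoelder bounds for weighted powers of the profile\<close>

lemma profile_power_lipschitz_y:
  assumes "0 < s" "0 < j"
  shows "\<bar>profile n y s ^ j - profile n y' s ^ j\<bar> \<le> j * (\<bar>y - y'\<bar> / s ^ n)"
proof -
  have "norm (profile n y s ^ j - profile n y' s ^ j) \<le> (j / s ^ n) * norm (y - y')"
  proof (rule field_differentiable_bound[of UNIV])
    fix z
    show "((\<lambda>y. profile n y s ^ j) has_field_derivative
        j * profile n z s ^ (j - 1) * profile_dy n z s) (at z within UNIV)"
      using profile_has_dy[OF assms(1), of n z UNIV]
      by (auto intro!: derivative_eq_intros)
    \<comment> \<open>The profile has values in \<open>[0, 1]\<close>, so its powers do not enlarge
      the bound on the derivative.\<close>
    have "\<bar>profile n z s ^ (j - 1)\<bar> * \<bar>profile_dy n z s\<bar> \<le> 1 * (1 / s ^ n)"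
      using abs_profile_dy_le[OF assms(1), of n z] profile_nonneg[of n z s] profile_le_1[of n z s]
      by (intro mult_mono) (auto intro: power_le_one)
    then have "j * (\<bar>profile n z s ^ (j - 1)\<bar> * \<bar>profile_dy n z s\<bar>) \<le> j * (1 * (1 / s ^ n))"
      by (intro mult_left_mono) auto
    then show "norm (j * profile n z s ^ (j - 1) * profile_dy n z s) \<le> j / s ^ n"
      by (simp add: abs_mult mult.assoc)
  qed auto
  then show ?thesis by simp
qed

text \<open>Powers of the profile differ by at most 1 and are Lipschitz in \<open>y\<close> with
  constant \<open>j / s ^ n\<close>. Interpolation costs \<open>s powr (- \<alpha> * n)\<close>, and
  the remaining power of \<open>s\<close> has exponent \<open>p - \<alpha> * n \<ge> 0\<close>, so
  it is largest at \<open>s = T\<close>.\<close>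

lemma weighted_profile_holder_y:
  assumes "0 < \<alpha>" "\<alpha> < 1" "0 \<le> s" "s \<le> T" "0 < j" "0 < p" "\<alpha> * n \<le> p"
  shows "\<bar>s ^ p * profile n y s ^ j - s ^ p * profile n y' s ^ j\<bar>
    \<le> (j * T powr (p - \<alpha> * n)) * \<bar>y - y'\<bar> powr \<alpha>"
\<comment> \<open>At \<open>s = 0\<close> the weight \<open>s ^ p\<close> vanishes, as
  \<open>p\<close> is positive.\<close>
proof (cases "s = 0")
  case True
  then show ?thesis using assms by (simp add: zero_power)
next
  case False
  then have s: "0 < s" using assms by simp
  have "\<bar>profile n y s ^ j - profile n y' s ^ j\<bar> \<le> 1"
    using profile_nonneg[of n y s] profile_le_1[of n y s] profile_nonneg[of n y' s] profile_le_1[of n y' s]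
      power_le_one[of "profile n y s" j] power_le_one[of "profile n y' s" j]
      zero_le_power[of "profile n y s" j] zero_le_power[of "profile n y' s" j]
    by linarith
  then have "\<bar>profile n y s ^ j - profile n y' s ^ j\<bar> \<le> j * (\<bar>y - y'\<bar> / s ^ n) powr \<alpha>"
    using assms s profile_power_lipschitz_y[OF s \<open>0 < j\<close>, of n y y']
    by (intro le_powr_interpolate) auto
  then have "s ^ p * \<bar>profile n y s ^ j - profile n y' s ^ j\<bar>
      \<le> s ^ p * (j * (\<bar>y - y'\<bar> / s ^ n) powr \<alpha>)"
    using s by (intro mult_left_mono) auto
  also have "\<dots> = j * s powr (p - \<alpha> * n) * \<bar>y - y'\<bar> powr \<alpha>"
    using s by (simp add: powr_divide powr_diff powr_realpow[symmetric] powr_powr mult_ac)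
  also have "\<dots> \<le> j * T powr (p - \<alpha> * n) * \<bar>y - y'\<bar> powr \<alpha>"
    using s assms by (intro mult_right_mono mult_left_mono powr_mono2) auto
  finally show ?thesis
    using s by (simp add: abs_mult right_diff_distrib[symmetric])
qed

text \<open>The weight absorbs the factor \<open>1 / s\<close> from the derivative of the profile,
  at the price of one power of \<open>s\<close>.\<close>

lemma weighted_profile_has_ds:
  assumes "0 < s" "0 < n" "0 < p"
  shows "((\<lambda>s. s ^ p * profile n y s ^ j) has_real_derivative
    s ^ (p - 1) * (p * profile n y s ^ j + 2 * n * j * profile n y s ^ j * (1 - profile n y s)))
    (at s within A)"
proof -
  let ?w = "profile n y s"
  have "((\<lambda>s. s ^ p * profile n y s ^ j) has_real_derivative
     p * s ^ (p - 1) * ?w ^ j + j * ?w ^ (j - 1) * (2 * n / s * (?w * (1 - ?w))) * s ^ p) (at s within A)"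
    using profile_has_ds[OF assms(1,2), of y A] by (auto intro!: derivative_eq_intros)
  moreover have "p * s ^ (p - 1) * ?w ^ j + j * ?w ^ (j - 1) * (2 * n / s * (?w * (1 - ?w))) * s ^ p
    = s ^ (p - 1) * (p * ?w ^ j + 2 * n * j * ?w ^ j * (1 - ?w))"
  \<comment> \<open>The split deals with the truncated exponent \<open>j - 1\<close>: at
    \<open>j = 0\<close> the factor \<open>j\<close> removes the term, otherwise
    \<open>w ^ (j - 1) * w = w ^ j\<close>.\<close>
  proof (cases j)
    case 0
    then show ?thesis by simp
  next
    case (Suc i)
    obtain q where "p = Suc q" using assms(3) gr0_implies_Suc by blast
    with Suc show ?thesis using assms(1) by (simp add: field_simps)
  qed
  ultimately show ?thesis by simp
qed

lemma weighted_profile_lipschitz_s: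
  assumes "s \<in> {0..T}" "s' \<in> {0..T}" "0 < n" "0 < p"
  shows "\<bar>s ^ p * profile n y s ^ j - s' ^ p * profile n y s' ^ j\<bar>
    \<le> (T ^ (p - 1) * (p + 2 * n * j)) * \<bar>s - s'\<bar>"
  using assms(1,2)
proof (induction s s' rule: linorder_wlog)
  case (sym s s')
  then show ?case by (simp add: abs_minus_commute)
next
  case (le s s')
  let ?F = "\<lambda>s. s ^ p * profile n y s ^ j" and ?K = "T ^ (p - 1) * (p + 2 * n * j)"
  \<comment> \<open>At \<open>y = 0\<close> the profile itself jumps from 1 to the value 0 of
    \<open>0 / 0\<close>; the weight \<open>s ^ p\<close> forces the product to 0.\<close>
  have cont0: "continuous (at 0 within {0..T}) ?F"
  proof -
    have "((\<lambda>s. s ^ p * profile n y s ^ j) \<longlongrightarrow> 0) (at 0 within {0..T})"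
    proof (rule Lim_null_comparison)
      show "\<forall>\<^sub>F s in at 0 within {0..T}. norm (s ^ p * profile n y s ^ j) \<le> \<bar>s\<bar> ^ p"
        using profile_nonneg[of n y] profile_le_1[of n y]
        by (auto simp: abs_mult power_abs intro!: always_eventually mult_left_le power_le_one)
      show "((\<lambda>s. \<bar>s\<bar> ^ p) \<longlongrightarrow> 0) (at 0 within {0..T})"
        using assms(4) by (auto intro!: tendsto_eq_intros)
    qed
    then show ?thesis using assms(4) by (simp add: continuous_within zero_power)
  qed
  show ?case
  proof (cases "s = s'")
    case True
    then show ?thesis by simp
  next
    case False
    with le have lt: "s < s'" by simp
    have deriv: "(?F has_real_derivative
        x ^ (p - 1) * (p * profile n y x ^ j + 2 * n * j * profile n y x ^ j * (1 - profile n y x)))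
        (at x within A)" if "0 < x" for x A
      using weighted_profile_has_ds[OF that assms(3,4)] by simp
    have cont: "continuous_on {s..s'} ?F"
      unfolding continuous_on_eq_continuous_within
    proof
      fix x assume x: "x \<in> {s..s'}"
      show "continuous (at x within {s..s'}) ?F"
      proof (cases "x = 0")
        case True
        then show ?thesis
          using continuous_within_subset[OF cont0, of "{s..s'}"] le by auto
      next
        case False
        with x le have "0 < x" by auto
        then show ?thesis
          using deriv DERIV_continuous by blast
      qed
    qed
    have deriv': "(?F has_derivative (*) (x ^ (p - 1) *
        (p * profile n y x ^ j + 2 * n * j * profile n y x ^ j * (1 - profile n y x)))) (at x)"
      if "s < x" "x < s'" for x
      using deriv[of x UNIV] that le unfolding has_field_derivative_def by simp
    obtain x where x: "s < x" "x < s'" and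
      eq: "?F s' - ?F s = x ^ (p - 1) * (p * profile n y x ^ j
         + 2 * n * j * profile n y x ^ j * (1 - profile n y x)) * (s' - s)"
      by (rule mvt[OF lt cont deriv'])
    let ?w = "profile n y x"
    have w: "0 \<le> ?w" "?w \<le> 1" "?w ^ j \<le> 1" "0 \<le> ?w ^ j"
      by (auto simp: profile_nonneg profile_le_1 power_le_one)
    have "?w ^ j * (1 - ?w) \<le> 1" using w by (intro mult_le_one) auto
    then have "real (2 * n * j) * (?w ^ j * (1 - ?w)) \<le> real (2 * n * j) * 1"
      by (intro mult_left_mono) auto
    moreover have "real p * ?w ^ j \<le> real p * 1" using w by (intro mult_left_mono) auto
    ultimately have "p * ?w ^ j + 2 * n * j * ?w ^ j * (1 - ?w) \<le> p + 2 * n * j"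
      by (simp add: mult.assoc)
    moreover have "x ^ (p - 1) \<le> T ^ (p - 1)" using x le by (intro power_mono) auto
    moreover have "0 \<le> p * ?w ^ j + 2 * n * j * ?w ^ j * (1 - ?w)" using w by auto
    ultimately have "0 \<le> x ^ (p - 1) * (p * ?w ^ j + 2 * n * j * ?w ^ j * (1 - ?w))"
      "x ^ (p - 1) * (p * ?w ^ j + 2 * n * j * ?w ^ j * (1 - ?w)) \<le> ?K"
      using x le by (auto intro!: mult_mono)
    then have "\<bar>?F s' - ?F s\<bar> \<le> ?K * \<bar>s' - s\<bar>"
      unfolding eq abs_mult by (intro mult_right_mono) auto
    then show ?thesis by (simp add: abs_minus_commute)
  qed
qed

text \<open>
  Scaling \<open>y\<close> by \<open>s ^ n\<close> costs the factor \<open>s ^ (- \<alpha> * n)\<close> in the Hoelder seminorm; the weight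
  \<open>s ^ p\<close> compensates it.
\<close>

lemma weighted_profile_holder:
  assumes "0 < \<alpha>" "\<alpha> < 1" "0 < n" "0 < j" "0 < p" "\<alpha> * n \<le> p" "0 < T"
  shows "holder_on 0 \<alpha> (UNIV \<times> {0..T})
    (\<lambda>q :: (real^3) \<times> real. (T - snd q) ^ p * profile n (fst q $ 2) (T - snd q) ^ j)"
    (is "holder_on 0 \<alpha> ?S (\<lambda>q. ?F (fst q $ 2) (T - snd q))")
proof -
  let ?A = "j * T powr (p - \<alpha> * n)" and ?B = "T ^ (p - 1) * (p + 2 * n * j) * T powr (1 - \<alpha>)"
  have bd: "\<bar>?F y s\<bar> \<le> T ^ p" if "s \<in> {0..T}" for y s
  proof -
    have "s ^ p * profile n y s ^ j \<le> T ^ p * 1"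
      using that profile_nonneg[of n y s] profile_le_1[of n y s]
      by (intro mult_mono power_mono power_le_one) auto
    moreover have "0 \<le> s ^ p * profile n y s ^ j"
      using that profile_nonneg[of n y s] by auto
    ultimately show ?thesis by simp
  qed
  have "norm (?F (fst q $ 2) (T - snd q) - ?F (fst r $ 2) (T - snd r))
      \<le> (?A + ?B) * dist q r powr \<alpha>" if "q \<in> ?S" "r \<in> ?S" for q r :: "(real^3) \<times> real"
  proof -
    define y s y' s' where "y = fst q $ 2" "s = T - snd q" "y' = fst r $ 2" "s' = T - snd r"
    note d = this
    have s: "s \<in> {0..T}" "s' \<in> {0..T}" using that by (auto simp: d)
    have "\<bar>y - y'\<bar> \<le> dist (fst q) (fst r)"
      using component_le_norm_cart[of "fst q - fst r" 2] by (simp add: d dist_norm)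
    also have "\<dots> \<le> dist q r" by (rule dist_fst_le)
    finally have dy: "\<bar>y - y'\<bar> \<le> dist q r" .
    have ds: "\<bar>s - s'\<bar> \<le> dist q r"
      using dist_snd_le[of q r] by (simp add: d dist_real_def abs_minus_commute)
    \<comment> \<open>The increment is split at the intermediate point \<open>(y', s)\<close>: first
      \<open>y\<close> moves at fixed \<open>s\<close>, then \<open>s\<close> moves at fixed
      \<open>y'\<close>.\<close>
    have "\<bar>?F y s - ?F y' s\<bar> \<le> ?A * \<bar>y - y'\<bar> powr \<alpha>"
      using assms s by (intro weighted_profile_holder_y) auto
    also have "\<dots> \<le> ?A * dist q r powr \<alpha>"
      using assms dy by (intro mult_left_mono powr_mono2) auto
    finally have 1: "\<bar>?F y s - ?F y' s\<bar> \<le> ?A * dist q r powr \<alpha>" .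
    \<comment> \<open>On the bounded time interval a Lipschitz bound is a Hoelder bound, with the
      extra factor \<open>T powr (1 - \<alpha>)\<close>.\<close>
    have "\<bar>s - s'\<bar> = \<bar>s - s'\<bar> powr (1 - \<alpha>) * \<bar>s - s'\<bar> powr \<alpha>"
      by (simp add: powr_add[symmetric])
    also have "\<dots> \<le> T powr (1 - \<alpha>) * dist q r powr \<alpha>"
      using assms ds s by (intro mult_mono powr_mono2) auto
    finally have "T ^ (p - 1) * (p + 2 * n * j) * \<bar>s - s'\<bar>
        \<le> T ^ (p - 1) * (p + 2 * n * j) * (T powr (1 - \<alpha>) * dist q r powr \<alpha>)"
      using assms by (intro mult_left_mono) auto
    with weighted_profile_lipschitz_s[OF s assms(3,5), of y' j]
    have 2: "\<bar>?F y' s - ?F y' s'\<bar> \<le> ?B * dist q r powr \<alpha>"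
      by (simp add: mult.assoc)
    have "\<bar>?F y s - ?F y' s'\<bar> \<le> \<bar>?F y s - ?F y' s\<bar> + \<bar>?F y' s - ?F y' s'\<bar>" by linarith
    also have "\<dots> \<le> (?A + ?B) * dist q r powr \<alpha>" using 1 2 by (simp add: distrib_right)
    finally show ?thesis by (simp add: d)
  qed
  moreover have "bounded ((\<lambda>q. ?F (fst q $ 2) (T - snd q)) ` ?S)"
    unfolding bounded_iff by (intro exI[of _ "T ^ p"]) (use bd in auto)
  ultimately show ?thesis unfolding holder_on.simps by blast
qed

section \<open>Parallel shear flows\<close>

lemma partial_deriv_const: "partial_deriv i (\<lambda>x. c) x = 0"
  by (simp add: partial_deriv_def)

text \<open>The coefficient \<open>c\<close> is a vector in the convection term and a scalar in the
  component derivatives of divergence and curl.\<close>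

lemma partial_deriv_shear:
  assumes "(U has_real_derivative U') (at (x $ 2))"
  shows "partial_deriv i (\<lambda>x. U (x $ 2) *\<^sub>R c) x = (if i = 2 then U' *\<^sub>R c else 0)"
proof -
  have "((\<lambda>x :: real^3. x $ 2) has_derivative (\<lambda>h. h $ 2)) (at x)"
    by (intro bounded_linear_imp_has_derivative bounded_linear_vec_nth)
  from has_derivative_compose[OF this, of U "(*) U'"] assms
  have "((\<lambda>x. U (x $ 2)) has_derivative (\<lambda>h. U' * h $ 2)) (at x)"
    by (simp add: has_field_derivative_def)
  then have "((\<lambda>x. U (x $ 2) *\<^sub>R c) has_derivative (\<lambda>h. (U' * h $ 2) *\<^sub>R c)) (at x)"
    by (rule has_derivative_scaleR_left)
  then show ?thesis
    unfolding partial_deriv_def by (simp add: frechet_derivative_at[symmetric] axis_def)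
qed

lemma partial_deriv_shear_component:
  assumes "(U has_real_derivative U') (at (x $ 2))"
  shows "partial_deriv i (\<lambda>x. (U (x $ 2) *\<^sub>R axis 1 1 :: real^3) $ j) x
    = (if i = 2 \<and> j = 1 then U' else 0)"
  using partial_deriv_shear[OF assms, of i "axis 1 1 $ j :: real"]
  by (auto simp: axis_def)

lemma divergence_shear:
  assumes "(U has_real_derivative U') (at (x $ 2))"
  shows "divergence (\<lambda>x. U (x $ 2) *\<^sub>R axis 1 1) x = 0"
  unfolding divergence_def by (simp only: partial_deriv_shear_component[OF assms] sum_3) simp

text \<open>The velocity points in direction 1 and varies only in direction 2, so each summand has a
  vanishing factor.\<close>

lemma convection_shear:
  assumes "(U has_real_derivative U') (at (x $ 2))"
  shows "convection (\<lambda>x. U (x $ 2) *\<^sub>R axis 1 1) x = 0"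
  unfolding convection_def by (simp add: partial_deriv_shear[OF assms] sum_3 axis_def)

lemma curl_shear:
  assumes "(U has_real_derivative U') (at (x $ 2))"
  shows "curl (\<lambda>x. U (x $ 2) *\<^sub>R axis 1 1) x = - U' *\<^sub>R axis 3 1"
  unfolding curl_def partial_deriv_shear_component[OF assms]
  by (simp add: vec_eq_iff forall_3 axis_def)

lemma grad_const: "grad (\<lambda>x. c) x = 0"
  by (simp add: grad_def partial_deriv_const vec_eq_iff)

section \<open>Function spaces\<close>

text \<open>By continuity the set where the bound holds is closed; having full measure, it is the
  whole space. Thus a single point bounds the essential supremum from below.\<close>

lemma Linf_norm_ge:
  fixes u :: "real^3 \<Rightarrow> 'b::euclidean_space"
  assumes "continuous_on UNIV u"
  shows "ennreal (norm (u x)) \<le> Linf_norm u"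
proof -
  have "continuous_on UNIV (\<lambda>x. ennreal (norm (u x)))"
    using assms by (intro continuous_on_ennreal continuous_on_norm)
  then have "closed {x. ennreal (norm (u x)) \<le> Linf_norm u}"
    by (intro closed_Collect_le continuous_on_const)
  then have "x \<in> {x. ennreal (norm (u x)) \<le> Linf_norm u}"
    using esssup_AE[of "\<lambda>x. ennreal (norm (u x))" lebesgue]
    by (intro mem_closed_if_AE_lebesgue) (auto simp: Linf_norm_def)
  then show ?thesis by simp
qed

lemma Linf_norm_le:
  fixes u :: "real^3 \<Rightarrow> 'b::euclidean_space"
  assumes "continuous_on UNIV u" "\<And>x. norm (u x) \<le> c"
  shows "Linf_norm u \<le> ennreal c"
  unfolding Linf_norm_def
proof (rule esssup_I)
  have "u \<in> borel_measurable lebesgue"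
    using borel_measurable_continuous_onI[OF assms(1)] by (simp add: measurable_completion)
  then show "(\<lambda>x. ennreal (norm (u x))) \<in> borel_measurable lebesgue" by measurable
qed (use assms(2) in \<open>auto intro: ennreal_leI\<close>)

lemma zero_in_Lq_space: "(\<lambda>x. 0 :: 'b::euclidean_space) \<in> Lq_space q"
  using Linf_norm_le[of "\<lambda>x. 0 :: 'b" 0] by (simp add: Lq_space_def continuous_on_const)

text \<open>This is the initial velocity of the flow below; zero serves as each of its weak
  derivatives.\<close>

lemma zero_in_solenoidal_data_space: "(\<lambda>x. 0) \<in> solenoidal_data_space"
proof -
  have "weak_deriv \<beta> (\<lambda>x. 0 :: real^3) (\<lambda>x. 0)" for \<beta>
    by (simp add: weak_deriv_def)
  then have "(\<lambda>x. 0 :: real^3) \<in> sobolev_space k q" for k q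
    using zero_in_Lq_space by (auto simp: sobolev_space_def)
  then show ?thesis
    by (simp add: solenoidal_data_space_def data_space_def smooth_on_const
        divergence_def partial_deriv_const)
qed

section \<open>The blow-up\<close>

text \<open>
  The function \<open>G\<close> for \<open>n = m + 2\<close>, with its partial derivatives \<open>G\<^sub>y\<close> and \<open>G\<^sub>s\<close>.
\<close>

definition focus :: "nat \<Rightarrow> real \<Rightarrow> real \<Rightarrow> real"
  where "focus m y s = s ^ (m + 1) * profile (m + 2) y s"

definition focus_dy :: "nat \<Rightarrow> real \<Rightarrow> real \<Rightarrow> real"
  where "focus_dy m y s = s ^ (m + 1) * profile_dy (m + 2) y s"

text \<open>Expanded into the terms \<open>s ^ m * profile ^ j\<close> for \<open>j = 1, 2\<close>,
  with the exponent 1 kept visible, so that the weighted Hoelder bound applies to each.\<close>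

definition focus_ds :: "nat \<Rightarrow> real \<Rightarrow> real \<Rightarrow> real"
  where "focus_ds m y s = (3 * m + 5) * (s ^ m * profile (m + 2) y s ^ 1)
    - 2 * (m + 2) * (s ^ m * profile (m + 2) y s ^ 2)"

lemma focus_has_dy:
  "0 < s \<Longrightarrow> ((\<lambda>y. focus m y s) has_real_derivative focus_dy m y s) (at y)"
  unfolding focus_def focus_dy_def by (intro DERIV_cmult profile_has_dy)

text \<open>With \<open>n = m + 2\<close>, weight exponent \<open>m + 1\<close> and
  \<open>j = 1\<close>, the bracket \<open>(m + 1) w + 2 (m + 2) w (1 - w)\<close> equals
  \<open>(3 m + 5) w - 2 (m + 2) w\<^sup>2\<close>.\<close>

lemma focus_has_ds:
  assumes "0 < s"
  shows "((\<lambda>s. focus m y s) has_real_derivative focus_ds m y s) (at s within A)"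
  using weighted_profile_has_ds[OF assms, of "m + 2" "m + 1" y 1 A]
  unfolding focus_def focus_ds_def by (simp add: algebra_simps power2_eq_square)

lemma abs_focus_dy_le:
  assumes "0 < s"
  shows "\<bar>focus_dy m y s\<bar> \<le> 1 / s"
proof -
  have "s ^ (m + 1) * \<bar>profile_dy (m + 2) y s\<bar> \<le> s ^ (m + 1) * (1 / s ^ (m + 2))"
    using assms by (intro mult_left_mono abs_profile_dy_le) auto
  then show ?thesis using assms by (simp add: focus_dy_def abs_mult)
qed

lemma focus_dy_at_scale: "0 < s \<Longrightarrow> focus_dy m (s ^ (m + 2)) s = - 1 / (2 * s)"
  unfolding focus_dy_def by (simp only: profile_dy_at_scale) simp

lemma continuous_on_focus_dy: "0 < s \<Longrightarrow> continuous_on A (\<lambda>y. focus_dy m y s)"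
  unfolding focus_dy_def profile_dy_def
  using profile_denom_pos[of s "m + 2"]
  by (intro continuous_intros) (auto simp: less_le)

section \<open>Smoothness before the final time\<close>

lemma smooth_on_time_to_go: "smooth_on S (\<lambda>q :: (real^3) \<times> real. T - snd q)"
  by (intro smooth_on_diff smooth_on_const smooth_on_bounded_linear bounded_linear_snd)

lemma smooth_on_second_coordinate: "smooth_on S (\<lambda>q :: (real^3) \<times> real. fst q $ 2)"
  by (intro smooth_on_bounded_linear bounded_linear_vec_nth[THEN bounded_linear_compose]
      bounded_linear_fst)

text \<open>A general positive \<open>\<sigma>\<close> covers both the time to go
  \<open>T - t\<close> and the constant \<open>T\<close> of the subtracted initial profile.\<close>

lemma smooth_on_profile:
  assumes "smooth_on S \<sigma>" "\<And>q. q \<in> S \<Longrightarrow> 0 < \<sigma> q"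
  shows "smooth_on S (\<lambda>q :: (real^3) \<times> real. profile n (fst q $ 2) (\<sigma> q))"
proof -
  have "\<sigma> q ^ (2 * n) + (fst q $ 2)\<^sup>2 \<noteq> 0" if "q \<in> S" for q
    using profile_denom_pos[OF assms(2)[OF that], of n "fst q $ 2"] by simp
  then show ?thesis
    unfolding profile_def
    by (intro smooth_on_divide smooth_on_add smooth_on_power smooth_on_second_coordinate assms(1))
qed

lemma smooth_on_focus:
  assumes "smooth_on S \<sigma>" "\<And>q. q \<in> S \<Longrightarrow> 0 < \<sigma> q"
  shows "smooth_on S (\<lambda>q :: (real^3) \<times> real. focus m (fst q $ 2) (\<sigma> q))"
  unfolding focus_def using assms by (intro smooth_on_mult smooth_on_power smooth_on_profile)

lemma smooth_on_focus_ds: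
  assumes "smooth_on S \<sigma>" "\<And>q. q \<in> S \<Longrightarrow> 0 < \<sigma> q"
  shows "smooth_on S (\<lambda>q :: (real^3) \<times> real. focus_ds m (fst q $ 2) (\<sigma> q))"
  unfolding focus_ds_def using assms
  by (intro smooth_on_diff smooth_on_mult smooth_on_const smooth_on_power smooth_on_profile)

section \<open>Regularity of velocity and force\<close>

definition velocity :: "nat \<Rightarrow> real \<Rightarrow> (real^3) \<times> real \<Rightarrow> real^3"
  where "velocity m T q =
    (focus m (fst q $ 2) (T - snd q) - focus m (fst q $ 2) T) *\<^sub>R axis 1 1"

definition force :: "nat \<Rightarrow> real \<Rightarrow> (real^3) \<times> real \<Rightarrow> real^3"
  where "force m T q = (- focus_ds m (fst q $ 2) (T - snd q)) *\<^sub>R axis 1 1"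

lemma smooth_on_velocity:
  assumes "0 < T"
  shows "smooth_on (UNIV \<times> {0..<T}) (velocity m T)"
  unfolding velocity_def[abs_def] using assms
  by (intro smooth_on_compose_bounded_linear[OF bounded_linear_scaleR_left] smooth_on_diff
      smooth_on_focus smooth_on_time_to_go smooth_on_const) auto

lemma smooth_on_force: "smooth_on (UNIV \<times> {0..<T}) (force m T)"
  unfolding force_def[abs_def]
  by (intro smooth_on_compose_bounded_linear[OF bounded_linear_scaleR_left] smooth_on_minus
      smooth_on_focus_ds smooth_on_time_to_go) auto

lemma holder_on_velocity:
  assumes "0 < T" "0 < \<alpha>" "\<alpha> < 1" "\<alpha> * (m + 2) \<le> m"
  shows "holder_on 0 \<alpha> (UNIV \<times> {0..T}) (velocity m T)"
proof -
  let ?S = "UNIV \<times> {0..T} :: ((real^3) \<times> real) set"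
  have *: "holder_on 0 \<alpha> ?S (\<lambda>q. focus m (fst q $ 2) (T - snd q))"
    using weighted_profile_holder[of \<alpha> "m + 2" 1 "m + 1" T] assms by (simp add: focus_def)
  \<comment> \<open>Freezing time at 0 sets the time to go to \<open>T\<close>, which gives the
    subtracted initial profile.\<close>
  have "holder_on 0 \<alpha> ?S (\<lambda>q. focus m (fst (fst q, 0 :: real) $ 2) (T - snd (fst q, 0)))"
    by (rule holder_on_0_compose_nonexpansive[OF _ *])
       (use assms in \<open>auto simp: dist_Pair_Pair dist_fst_le[unfolded fst_conv]\<close>)
  then have "holder_on 0 \<alpha> ?S (\<lambda>q. focus m (fst q $ 2) T)" by simp
  with * show ?thesis
    unfolding velocity_def[abs_def]
    by (intro holder_on_0_compose_bounded_linear[OF bounded_linear_scaleR_left] holder_on_0_diff)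
qed

text \<open>The force carries the weight \<open>s ^ m\<close>, one power less than the velocity;
  \<open>\<alpha> * (m + 2) \<le> m\<close> is what the weighted Hoelder bound asks for at this
  weight.\<close>

lemma holder_on_force:
  assumes "0 < T" "0 < \<alpha>" "\<alpha> < 1" "\<alpha> * (m + 2) \<le> m"
  shows "holder_on 0 \<alpha> (UNIV \<times> {0..T}) (force m T)"
proof -
  have "0 < \<alpha> * (m + 2)" using assms by simp
  \<comment> \<open>Since \<open>\<alpha> * (m + 2)\<close> is positive, \<open>m = 0\<close> is
    excluded and the weight vanishes at the final time.\<close>
  then have "0 < m" using assms by (cases m) auto
  then have *: "holder_on 0 \<alpha> (UNIV \<times> {0..T})
     (\<lambda>q :: (real^3) \<times> real. (T - snd q) ^ m * profile (m + 2) (fst q $ 2) (T - snd q) ^ j)"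
    if "0 < j" for j
    using weighted_profile_holder[of \<alpha> "m + 2" j m T] assms that by simp
  show ?thesis
    unfolding force_def[abs_def] focus_ds_def
    by (intro holder_on_0_compose_bounded_linear[OF bounded_linear_scaleR_left]
        holder_on_0_compose_bounded_linear[OF bounded_linear_minus[OF bounded_linear_ident]]
        holder_on_0_compose_bounded_linear[OF bounded_linear_mult_right] holder_on_0_diff *) auto
qed

section \<open>The Euler equations\<close>

lemma velocity_profile_has_dy:
  assumes "0 < T" "t < T"
  shows "((\<lambda>y. focus m y (T - t) - focus m y T) has_real_derivative
    focus_dy m y (T - t) - focus_dy m y T) (at y)"
  using assms by (intro DERIV_diff focus_has_dy) auto

lemma velocity_has_time_derivative:
  assumes "t < T"
  shows "((\<lambda>s. velocity m T (x, s)) has_vector_derivative force m T (x, t)) (at t within A)"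
proof -
  have "((\<lambda>s. T - s) has_real_derivative - 1) (at t within A)"
    by (auto intro!: derivative_eq_intros)
  from DERIV_chain2[OF focus_has_ds this] assms
  have "((\<lambda>s. focus m (x $ 2) (T - s)) has_real_derivative
      focus_ds m (x $ 2) (T - t) * - 1) (at t within A)" by simp
  then have "((\<lambda>s. focus m (x $ 2) (T - s) - focus m (x $ 2) T) has_real_derivative
      - focus_ds m (x $ 2) (T - t)) (at t within A)"
    by (auto intro!: derivative_eq_intros)
  then have "((\<lambda>s. (focus m (x $ 2) (T - s) - focus m (x $ 2) T) *\<^sub>R (axis 1 1 :: real^3))
      has_vector_derivative (- focus_ds m (x $ 2) (T - t)) *\<^sub>R axis 1 1) (at t within A)"
    by (intro has_vector_derivative_scaleR[where g = "\<lambda>_. axis 1 1" and g' = 0, simplified]) auto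
  then show ?thesis by (simp add: velocity_def force_def)
qed

lemma euler_solution_velocity:
  assumes "0 < T"
  shows "euler_solution T (force m T) (\<lambda>x. 0) (velocity m T) (\<lambda>q. 0)"
  unfolding euler_solution_def
proof (intro conjI allI ballI)
  fix x :: "real^3" and t assume t: "t \<in> {0..<T}"
  \<comment> \<open>\<open>vector_derivative\<close> is a choice among derivatives; at a limit point
    it is unique, also at \<open>t = 0\<close>, where it is one-sided.\<close>
  have "t islimpt {0..<T}"
    using t by (intro connected_imp_perfect) (auto dest: arg_cong[where f = infinite] simp: infinite_Ico)
  then have "vector_derivative (\<lambda>s. velocity m T (x, s)) (at t within {0..<T}) = force m T (x, t)"
    using t by (intro vector_derivative_within velocity_has_time_derivative)
      (auto simp: trivial_limit_within)
  moreover have "convection (\<lambda>y. velocity m T (y, t)) x = 0"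
    using convection_shear[OF velocity_profile_has_dy[OF assms]] t by (simp add: velocity_def)
  ultimately show "vector_derivative (\<lambda>s. velocity m T (x, s)) (at t within {0..<T})
      + convection (\<lambda>y. velocity m T (y, t)) x + grad (\<lambda>y. 0) x = force m T (x, t)"
    by (simp add: grad_const)
  show "divergence (\<lambda>y. velocity m T (y, t)) x = 0"
    using divergence_shear[OF velocity_profile_has_dy[OF assms]] t by (simp add: velocity_def)
qed (simp add: velocity_def)

section \<open>Vorticity and its time integral\<close>

lemma curl_velocity:
  assumes "0 < T" "t < T"
  shows "curl (\<lambda>x. velocity m T (x, t)) x
    = - (focus_dy m (x $ 2) (T - t) - focus_dy m (x $ 2) T) *\<^sub>R axis 3 1"
  using curl_shear[OF velocity_profile_has_dy[OF assms]] by (simp add: velocity_def)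

lemma continuous_on_curl_velocity:
  assumes "0 < T" "t < T"
  shows "continuous_on UNIV (curl (\<lambda>x. velocity m T (x, t)))"
proof -
  have "continuous_on UNIV (\<lambda>x :: real^3. focus_dy m (x $ 2) s)" if "0 < s" for s
    by (rule continuous_on_compose2[OF continuous_on_focus_dy[OF that, of UNIV]])
       (auto intro: continuous_intros)
  then show ?thesis
    unfolding curl_velocity[OF assms, abs_def] using assms by (intro continuous_intros) auto
qed

lemma Linf_norm_curl_velocity_le:
  assumes "0 < T" "t < T"
  shows "Linf_norm (curl (\<lambda>x. velocity m T (x, t))) \<le> ennreal (1 / (T - t) + 1 / T)"
proof (rule Linf_norm_le[OF continuous_on_curl_velocity[OF assms]])
  fix x
  show "norm (curl (\<lambda>x. velocity m T (x, t)) x) \<le> 1 / (T - t) + 1 / T"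
    using abs_focus_dy_le[of "T - t" m "x $ 2"] abs_focus_dy_le[of T m "x $ 2"] assms
    by (simp add: curl_velocity norm_axis_1)
qed

lemma Linf_norm_curl_velocity_ge:
  assumes "0 < T" "t < T"
  shows "ennreal (1 / (2 * (T - t)) - 1 / T) \<le> Linf_norm (curl (\<lambda>x. velocity m T (x, t)))"
proof -
  let ?y = "(T - t) ^ (m + 2)"
  \<comment> \<open>The second coordinate sits at the scale \<open>(T - t) ^ (m + 2)\<close>, where
    \<open>focus_dy\<close> equals \<open>- 1 / (2 * (T - t))\<close>; the initial profile takes
    away at most \<open>1 / T\<close>.\<close>
  define x :: "real^3" where "x = (\<chi> i. ?y)"
  have "\<bar>focus_dy m ?y T\<bar> \<le> 1 / T" "focus_dy m ?y (T - t) = - 1 / (2 * (T - t))"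
    using assms by (intro abs_focus_dy_le focus_dy_at_scale; simp)+
  moreover have "norm (curl (\<lambda>x. velocity m T (x, t)) x) = \<bar>focus_dy m ?y (T - t) - focus_dy m ?y T\<bar>"
    by (simp add: curl_velocity[OF assms] norm_axis_1 x_def)
  ultimately have "1 / (2 * (T - t)) - 1 / T \<le> norm (curl (\<lambda>x. velocity m T (x, t)) x)"
    by simp
  then have "ennreal (1 / (2 * (T - t)) - 1 / T) \<le> ennreal (norm (curl (\<lambda>x. velocity m T (x, t)) x))"
    by (rule ennreal_leI)
  also have "\<dots> \<le> Linf_norm (curl (\<lambda>x. velocity m T (x, t)))"
    by (rule Linf_norm_ge[OF continuous_on_curl_velocity[OF assms]])
  finally show ?thesis .
qed

text \<open>The bound \<open>1 / (T - s) + 1 / T\<close> increases with \<open>s\<close>, so its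
  value at \<open>t\<close> dominates the integrand on \<open>[0, t]\<close>.\<close>

lemma vorticity_integral_velocity_finite:
  assumes "0 < T" "t \<in> {0..<T}"
  shows "vorticity_integral (velocity m T) t < \<infinity>"
proof -
  have "vorticity_integral (velocity m T) t
      \<le> (\<integral>\<^sup>+ s. ennreal (1 / (T - t) + 1 / T) * indicator {0..t} s \<partial>lborel)"
    unfolding vorticity_integral_def
  proof (intro nn_integral_mono)
    fix s
    have "Linf_norm (curl (\<lambda>x. velocity m T (x, s))) \<le> ennreal (1 / (T - t) + 1 / T)"
      if "s \<in> {0..t}"
    proof (rule order_trans[OF Linf_norm_curl_velocity_le ennreal_leI])
      show "1 / (T - s) + 1 / T \<le> 1 / (T - t) + 1 / T"
        using assms that by (intro add_right_mono divide_left_mono) auto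
    qed (use assms that in auto)
    then show "Linf_norm (curl (\<lambda>x. velocity m T (x, s))) * indicator {0..t} s
        \<le> ennreal (1 / (T - t) + 1 / T) * indicator {0..t} s"
      by (auto split: split_indicator)
  qed
  also have "\<dots> < \<infinity>"
    using assms by (simp add: nn_integral_cmult ennreal_mult_less_top)
  finally show ?thesis .
qed

text \<open>Integrate the pointwise lower bound over \<open>[T / 2, t]\<close> only: there
  \<open>2 * (T - s) \<le> T\<close>, so the bound is nonnegative.\<close>

lemma vorticity_integral_velocity_ge:
  assumes "0 < T" "t \<in> {T / 2..<T}"
  shows "ennreal (ln (T / 2) / 2 - 1 / 2 - ln (T - t) / 2) \<le> vorticity_integral (velocity m T) t"
proof -
  let ?g = "\<lambda>s. 1 / (2 * (T - s)) - 1 / T" and ?G = "\<lambda>s. - ln (T - s) / 2 - s / T"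
  \<comment> \<open>The linear part of \<open>?G\<close> contributes \<open>1 / 2 - t / T\<close>,
    which is at least \<open>- 1 / 2\<close>.\<close>
  have "ennreal (ln (T / 2) / 2 - 1 / 2 - ln (T - t) / 2) \<le> ennreal (?G t - ?G (T / 2))"
    using assms by (intro ennreal_leI) (simp add: field_simps)
  also have "\<dots> = (\<integral>\<^sup>+ s. ennreal (?g s) * indicator {T / 2..t} s \<partial>lborel)"
  proof (rule nn_integral_FTC_Icc[symmetric])
    fix s assume s: "s \<in> {T / 2..t}"
    then have "s < T" using assms by auto
    then show "(?G has_real_derivative ?g s) (at s)"
      using assms by (auto intro!: derivative_eq_intros simp: field_simps)
    show "0 \<le> ?g s"
      using assms s \<open>s < T\<close> by (simp add: field_simps)
  qed (use assms in auto)
  also have "\<dots> \<le> vorticity_integral (velocity m T) t"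
    unfolding vorticity_integral_def
  proof (intro nn_integral_mono)
    fix s
    show "ennreal (?g s) * indicator {T / 2..t} s
        \<le> Linf_norm (curl (\<lambda>x. velocity m T (x, s))) * indicator {0..t} s"
      using Linf_norm_curl_velocity_ge[OF assms(1), of s m] assms
      by (auto split: split_indicator)
  qed
  finally show ?thesis .
qed

lemma vorticity_integral_velocity_tendsto:
  assumes "0 < T"
  shows "(vorticity_integral (velocity m T) \<longlongrightarrow> \<infinity>) (at_left T)"
proof -
  have "filterlim (\<lambda>t. T - t) (at_right 0) (at_left T)"
    unfolding filterlim_at
    by (auto intro!: tendsto_eq_intros simp: eventually_at_filter)
  from filterlim_compose[OF ln_at_0 this]
  have "LIM t at_left T. - ln (T - t) :> at_top"
    by (simp add: filterlim_uminus_at_bot)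
  then have "LIM t at_left T. (1 / 2) * - ln (T - t) :> at_top"
    by (intro filterlim_tendsto_pos_mult_at_top[OF tendsto_const]) auto
  then have "LIM t at_left T. (ln (T / 2) / 2 - 1 / 2) + (1 / 2) * - ln (T - t) :> at_top"
    by (intro filterlim_tendsto_add_at_top[OF tendsto_const])
  then have lower: "((\<lambda>t. ennreal (ln (T / 2) / 2 - 1 / 2 - ln (T - t) / 2)) \<longlongrightarrow> top) (at_left T)"
    by (simp add: ennreal_tendsto_top_eq_at_top)
  have ge: "\<forall>\<^sub>F t in at_left T. ennreal (ln (T / 2) / 2 - 1 / 2 - ln (T - t) / 2)
      \<le> vorticity_integral (velocity m T) t"
    using eventually_at_left_real[of "T / 2" T] assms
    by (auto elim!: eventually_mono intro!: vorticity_integral_velocity_ge)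
  show ?thesis
  \<comment> \<open>Only lower neighbourhoods of infinity matter, and the logarithmic lower bound
    enters each of them eventually.\<close>
  proof (rule order_tendstoI)
    fix l :: ennreal assume "l < \<infinity>"
    then have "\<forall>\<^sub>F t in at_left T. l < ennreal (ln (T / 2) / 2 - 1 / 2 - ln (T - t) / 2)"
      using order_tendstoD(1)[OF lower] by simp
    with ge show "\<forall>\<^sub>F t in at_left T. l < vorticity_integral (velocity m T) t"
      by eventually_elim (rule less_le_trans)
  qed simp
qed

theorem theorem2p9:
  fixes T \<alpha> :: real
  assumes "T > 0" and "0 < \<alpha>" and "\<alpha> < 1"
  shows "\<exists>(f :: (real^3) \<times> real \<Rightarrow> real^3) (V0 :: real^3 \<Rightarrow> real^3).
    smooth_on (UNIV \<times> {0..<T}) f \<and>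
    holder_on 0 \<alpha> (UNIV \<times> {0..T}) f \<and>
    V0 \<in> solenoidal_data_space \<and>
    (\<exists>(V :: (real^3) \<times> real \<Rightarrow> real^3) (P :: (real^3) \<times> real \<Rightarrow> real).
      euler_solution T f V0 V P \<and>
      smooth_on (UNIV \<times> {0..<T}) V \<and>
      holder_on 0 \<alpha> (UNIV \<times> {0..T}) V \<and>
      (\<forall>t\<in>{0..<T}. vorticity_integral V t < \<infinity>) \<and>
      (vorticity_integral V \<longlongrightarrow> \<infinity>) (at_left T) \<and>
      holder_on 1 \<alpha> (UNIV \<times> {0..T}) P)"
proof -
  \<comment> \<open>The condition \<open>\<alpha> * (m + 2) \<le> m\<close> solved for
    \<open>m\<close>, using \<open>\<alpha> < 1\<close>.\<close>
  obtain m :: nat where "2 * \<alpha> / (1 - \<alpha>) \<le> m"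
    using real_arch_simple by blast
  then have m: "\<alpha> * (m + 2) \<le> m"
    using assms by (simp add: field_simps)
  show ?thesis
    using assms m
    by (intro exI[of _ "force m T"] exI[of _ "\<lambda>x. 0"] exI[of _ "velocity m T"] exI[of _ "\<lambda>q. 0"]
        conjI ballI smooth_on_force smooth_on_velocity holder_on_force holder_on_velocity
        holder_on_const zero_in_solenoidal_data_space euler_solution_velocity
        vorticity_integral_velocity_finite vorticity_integral_velocity_tendsto)
qed

end
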